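(* Let $n\ge2$ be an integer and let $p,q$ be real numbers with $p\neq0$ and $p>-\frac12$. Let $$ E(\theta_1,\ldots,\theta_n)=\sum_{1\le k<j\le n}\ln\frac{1}{|e^{i\theta_k}-e^{i\theta_j}|}+p\sum_{j=1}^{n}\ln\frac{1}{|1-e^{i\theta_j}|}+q\sum_{j=1}^{n}\theta_j,\qquad \theta_j\in(0,2\pi). $$ Let $\theta_1^{*}<\cdots<\theta_n^{*}$ be points of $(0,2\pi)$ such that $e^{i\theta_1^{*}},\ldots,e^{i\theta_n^{*}}$ are the zeros of the para-orthogonal polynomial $$ B_n(z)=\frac{(2\alpha)_n}{(\alpha+\beta)_n}\,{}_2F_1(-n,\alpha+\beta;2\alpha;1-z) $$ with parameters $\alpha=p$ and $\beta=2iq$. Then $\nabla_{\theta}E(\theta_1^{*},\ldots,\theta_n^{*})=0$. Moreover, $E$ attains its global minimum at the point $(\theta_1^{*},\ldots,\theta_n^{*})$ if and only if $p>0$.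
   Context: $i$ is the imaginary unit, $(a)_n=a(a+1)\cdots(a+n-1)$ is the Pochhammer symbol and ${}_2F_1$ is the Gauss hypergeometric function, so $B_n$ is a monic polynomial of degree $n$ in $z$. The function $E$ is the energy of $n$ unit masses at the variable points $e^{i\theta_1},\ldots,e^{i\theta_n}$ of the unit circle, together with a fixed mass $p$ at the point $1$ and a linear term in the angles. It is considered on points $(\theta_1,\ldots,\theta_n)\in(0,2\pi)^n$, is finite when the $\theta_j$ are pairwise distinct, and is taken to be $+\infty$ when two of them coincide. "Global minimum" refers to this whole domain. For $\alpha$ real with $\alpha>-\frac12$, $\alpha\ne0$, and $\beta$ purely imaginary, $B_n$ is a para-orthogonal polynomial with respect to the positive definite functional given by the weight $(2-2\cos\theta)^{\alpha}(-e^{i\theta})^{\beta}$ on the unit circle. *)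

theory Defs
  imports "HOL-Analysis.Analysis"
begin

text \<open>
  The Gauss hypergeometric function as the value of its power series. For \<open>a = -n\<close> the series
  terminates, since \<open>pochhammer (-n) k = 0\<close> for \<open>k > n\<close>, so the value is meaningful for every \<open>z\<close>
  as long as no \<open>pochhammer c k\<close> with \<open>k \<le> n\<close> vanishes.
\<close>

definition gauss_2F1 :: "complex \<Rightarrow> complex \<Rightarrow> complex \<Rightarrow> complex \<Rightarrow> complex" where
  "gauss_2F1 a b c z = eval_fps (fps_hypergeo [a, b] [c] 1) z"

definition para_orth_B :: "nat \<Rightarrow> complex \<Rightarrow> complex \<Rightarrow> complex \<Rightarrow> complex" where
  "para_orth_B n \<alpha> \<beta> z =
     pochhammer (2 * \<alpha>) n / pochhammer (\<alpha> + \<beta>) n *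
     gauss_2F1 (- of_nat n) (\<alpha> + \<beta>) (2 * \<alpha>) (1 - z)"

text \<open>The logarithmic interaction \<open>ln (1 / r)\<close> of two unit charges at distance \<open>r\<close>, with the value
  \<open>\<infinity>\<close> at \<open>r = 0\<close> (on the reals, \<open>ln (1 / 0) = 0\<close> in HOL).\<close>

definition log_interaction :: "real \<Rightarrow> ereal" where
  "log_interaction r = (if r = 0 then \<infinity> else ereal (ln (1 / r)))"

definition angle_domain :: "(real ^ 'n) set" where
  "angle_domain = {\<theta>. \<forall>j. \<theta> $ j \<in> {0<..<2 * pi}}"

text \<open>
  The coordinates are indexed by a finite linearly ordered type, which plays the role of
  \<open>{1, \<dots>, n}\<close>. The external field terms are finite on \<^const>\<open>angle_domain\<close>, so only the pair
  interactions need extended real values.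
\<close>

definition circle_energy :: "real \<Rightarrow> real \<Rightarrow> real ^ 'n::{finite, linorder} \<Rightarrow> ereal" where
  "circle_energy p q \<theta> =
     (\<Sum>k\<in>UNIV. \<Sum>j\<in>{k<..}. log_interaction (cmod (cis (\<theta> $ k) - cis (\<theta> $ j)))) +
     ereal (p * (\<Sum>j\<in>UNIV. ln (1 / cmod (1 - cis (\<theta> $ j))))) +
     ereal (q * (\<Sum>j\<in>UNIV. \<theta> $ j))"

end

theory Submission
  imports Defs
begin

text \<open>
  The polynomial \<open>B\<^sub>n\<close> has \<open>n\<close> distinct, hence simple, zeros \<open>z\<^sub>j\<close>, so
  \<open>B\<^sub>n''(z\<^sub>j) / B\<^sub>n'(z\<^sub>j) = 2 \<Sum>\<^sub>k\<^sub>\<noteq>\<^sub>j 1 / (z\<^sub>j - z\<^sub>k)\<close>. The hypergeometric differential equation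
  evaluates the left-hand side; since \<open>z\<^sub>j / (z\<^sub>j - z\<^sub>k) = 1/2 - (\<i>/2) cot ((\<theta>\<^sub>j - \<theta>\<^sub>k) / 2)\<close>, the result
  is exactly the vanishing of the gradient of the energy (Stieltjes' argument).

  For \<open>p > 0\<close> the energy is convex on the simplex \<open>0 < \<theta>\<^sub>1 < \<dots> < \<theta>\<^sub>n < 2\<pi>\<close>, because
  \<open>- ln (2 sin (u/2))\<close> is convex on \<open>(0, 2\<pi>)\<close>. A critical point is thus a minimum on the simplex,
  and by symmetry on the whole domain. For \<open>p < 0\<close> the energy tends to \<open>-\<infinity>\<close> as the first
  point approaches the fixed charge at \<open>1\<close>.
\<close>

section \<open>Terminating hypergeometric series\<close>

text \<open>Having as many distinct roots as its degree forces \<open>P\<close> to split into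
  distinct linear factors. With \<open>P = [:- w, 1:] * Q\<close>, the product rule gives
  \<open>Q\<close> and twice the derivative of \<open>Q\<close> as the values at \<open>w\<close>,
  and the logarithmic derivative of \<open>Q\<close> is the sum over the other roots.\<close>

lemma pderiv2_at_simple_root:
  fixes P :: "'a::field poly"
  assumes "P \<noteq> 0" and card: "card {z. poly P z = 0} = degree P" and w: "poly P w = 0"
  shows "poly (pderiv P) w \<noteq> 0"
    and "poly (pderiv (pderiv P)) w =
           2 * poly (pderiv P) w * (\<Sum>v\<in>{z. poly P z = 0} - {w}. 1 / (w - v))"
proof -
  define R where "R = {z. poly P z = 0}"
  have fin: "finite R"
    unfolding R_def using poly_roots_finite[OF \<open>P \<noteq> 0\<close>] .
  define Q where "Q = smult (lead_coeff P) (\<Prod>v\<in>R - {w}. [:- v, 1:])"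
  have "P = smult (lead_coeff P) (\<Prod>v\<in>R. [:- v, 1:])"
  \<comment> \<open>Both sides have degree at most \<open>degree P\<close>, share the coefficient
    there and agree on the \<open>degree P\<close> points of \<open>R\<close>.\<close>
  proof (rule poly_eqI_degree_lead_coeff[of _ "degree P" _ R])
    have deg: "degree (\<Prod>v\<in>R. [:- v, 1:]) = degree P"
      using card by (subst degree_prod_eq_sum_degree) (auto simp: R_def)
    have lead: "lead_coeff (\<Prod>v\<in>R. [:- v, 1:]) = 1"
      by (simp add: lead_coeff_prod)
    show "degree P \<le> degree P" "degree (smult (lead_coeff P) (\<Prod>v\<in>R. [:- v, 1:])) \<le> degree P"
      using deg by simp_all
    show "coeff P (degree P) = coeff (smult (lead_coeff P) (\<Prod>v\<in>R. [:- v, 1:])) (degree P)"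
      using lead unfolding deg by simp
    show "card R \<ge> degree P"
      using card by (simp add: R_def)
    show "poly P z = poly (smult (lead_coeff P) (\<Prod>v\<in>R. [:- v, 1:])) z" if "z \<in> R" for z
      using that fin by (auto simp: poly_prod R_def)
  qed
  also have "\<dots> = [:- w, 1:] * Q"
    using w fin by (subst prod.remove[of R w]) (simp_all only: Q_def R_def mem_Collect_eq mult_smult_right)
  finally have P: "P = [:- w, 1:] * Q" .
  have D: "pderiv P = Q + [:- w, 1:] * pderiv Q"
    by (subst P, subst pderiv_mult) (simp add: pderiv_pCons)
  have D2: "pderiv (pderiv P) = pderiv Q + pderiv Q + ([:- w, 1:] * pderiv (pderiv Q))"
    by (subst D, subst pderiv_add, subst pderiv_mult) (simp add: pderiv_pCons)
  have Qw: "poly Q w = poly (pderiv P) w"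
    by (simp add: D)
  show "poly (pderiv P) w \<noteq> 0"
    using \<open>P \<noteq> 0\<close> fin by (simp flip: Qw add: Q_def poly_prod)
  have "poly (pderiv Q) w = poly Q w * (\<Sum>v\<in>R - {w}. 1 / (w - v))"
  proof -
    have "(\<Prod>u\<in>R - {w} - {v}. w - u) = (\<Prod>u\<in>R - {w}. w - u) * (1 / (w - v))" if "v \<in> R - {w}" for v
      using that fin by (auto simp: prod.remove[of "R - {w}" v])
    then show ?thesis
      by (simp add: Q_def pderiv_smult pderiv_prod poly_sum poly_prod pderiv_pCons sum_distrib_left mult.assoc)
  qed
  then show "poly (pderiv (pderiv P)) w =
      2 * poly (pderiv P) w * (\<Sum>v\<in>{z. poly P z = 0} - {w}. 1 / (w - v))"
    by (simp add: D2 Qw R_def)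
qed

text \<open>The terminating series as a polynomial, which makes degree, roots and
  \<open>pderiv\<close> available. Its variable corresponds to \<open>1 - z\<close> in
  \<open>para_orth_B\<close>.\<close>

definition hypergeo_poly :: "nat \<Rightarrow> 'a \<Rightarrow> 'a \<Rightarrow> 'a::field_char_0 poly" where
  "hypergeo_poly n b c = (\<Sum>k\<le>n. monom (fps_nth (fps_hypergeo [- of_nat n, b] [c] 1) k) k)"

lemma fps_hypergeo_terminates:
  "k > n \<Longrightarrow> fps_nth (fps_hypergeo [- of_nat n, b] [c] 1) k = (0::'a::field_char_0)"
  by (simp add: pochhammer_of_nat_eq_0_iff)

lemma coeff_hypergeo_poly: "coeff (hypergeo_poly n b c) k = fps_nth (fps_hypergeo [- of_nat n, b] [c] 1) k"
  by (auto simp: hypergeo_poly_def coeff_sum fps_hypergeo_terminates simp del: fps_hypergeo_nth)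

lemma poly_hypergeo_poly: "poly (hypergeo_poly n b c) z = gauss_2F1 (- of_nat n) b c z"
proof -
  have "gauss_2F1 (- of_nat n) b c z = (\<Sum>k\<le>n. fps_nth (fps_hypergeo [- of_nat n, b] [c] 1) k * z ^ k)"
    unfolding gauss_2F1_def eval_fps_def
    by (rule suminf_finite) (auto simp: fps_hypergeo_terminates simp del: fps_hypergeo_nth)
  then show ?thesis
    by (simp add: hypergeo_poly_def poly_sum poly_monom del: fps_hypergeo_nth)
qed

lemma degree_hypergeo_poly:
  fixes b c :: "'a::field_char_0"
  assumes "pochhammer b n \<noteq> 0" and "pochhammer c n \<noteq> 0"
  shows "degree (hypergeo_poly n b c) = n"
proof (rule antisym)
  show "degree (hypergeo_poly n b c) \<le> n"
    by (rule degree_le) (auto simp: coeff_hypergeo_poly fps_hypergeo_terminates simp del: fps_hypergeo_nth)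
  show "n \<le> degree (hypergeo_poly n b c)"
    \<comment> \<open>None of the Pochhammer factors of the coefficient at \<open>n\<close>
      vanishes; a zero denominator would make that coefficient 0.\<close>
    using assms by (intro le_degree) (simp add: coeff_hypergeo_poly pochhammer_of_nat_eq_0_iff)
qed

text \<open>Comparing coefficients reduces Gauss's equation with first parameter
  \<open>- of_nat n\<close> to the two-term recurrence \<open>rec\<close>, whose denominators are
  nonzero by the assumption on \<open>c\<close>.\<close>

lemma hypergeo_ode:
  fixes b c :: "'a::field_char_0"
  assumes c: "\<And>k. c + of_nat k \<noteq> 0"
  shows "z * (1 - z) * poly (pderiv (pderiv (hypergeo_poly n b c))) z +
      (c - (1 - of_nat n + b) * z) * poly (pderiv (hypergeo_poly n b c)) z +
      of_nat n * b * poly (hypergeo_poly n b c) z = 0"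
proof -
  define F where "F = hypergeo_poly n b c"
  have rec: "of_nat (Suc k) * (c + of_nat k) * coeff F (Suc k) = (of_nat k - of_nat n) * (b + of_nat k) * coeff F k" for k
    using c[of k] of_nat_neq_0[of k, where ?'a='a]
    unfolding F_def coeff_hypergeo_poly fps_hypergeo_rec
    by (simp add: divide_simps add.commute del: of_nat_Suc fps_hypergeo_nth)
  have "pCons 0 (pderiv (pderiv F)) - pCons 0 (pCons 0 (pderiv (pderiv F))) + smult c (pderiv F)
      - smult (1 - of_nat n + b) (pCons 0 (pderiv F)) + smult (of_nat n * b) F = 0" (is "?L = 0")
  proof (rule poly_eqI)
    fix k
    show "coeff ?L k = coeff 0 k"
    proof (cases k)
      case 0
      then show ?thesis using rec[of 0] by (simp add: coeff_pderiv)
    next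
      case (Suc m)
      then have "coeff ?L k = of_nat (Suc k) * (c + of_nat k) * coeff F (Suc k) - (of_nat k - of_nat n) * (b + of_nat k) * coeff F k"
        \<comment> \<open>The doubly shifted term contributes only from \<open>k = 2\<close> on,
          hence the further split.\<close>
        by (cases m) (simp_all add: coeff_pderiv algebra_simps)
      then show ?thesis using rec[of k] by simp
    qed
  qed
  then have "poly ?L z = 0"
    by simp
  then show ?thesis
    by (simp add: F_def algebra_simps)
qed

section \<open>The logarithmic potential of a chord\<close>

text \<open>Kept real-valued: at angle 0 it is 0, because \<open>ln (1 / 0) = 0\<close>, so the
  diagonal of a double sum contributes nothing.\<close>

definition chord_potential :: "real \<Rightarrow> real" where
  "chord_potential u = ln (1 / cmod (1 - cis u))"

lemma cmod_one_minus_cis: "cmod (1 - cis u) = 2 * \<bar>sin (u / 2)\<bar>"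
  by (metis cis_conv_exp dist_exp_i_1 norm_minus_commute)

lemma cmod_cis_diff: "cmod (cis a - cis b) = cmod (1 - cis (b - a))"
proof -
  have "cis a - cis b = cis a * (1 - cis (b - a))"
    by (simp add: right_diff_distrib cis_mult)
  then show ?thesis
    by (simp only: norm_mult norm_cis mult_1)
qed

lemma sin_half_pos: "u \<in> {0<..<2 * pi} \<Longrightarrow> sin (u / 2) > 0"
  by (intro sin_gt_zero) auto

lemma cis_inj_on: "inj_on cis {0<..<2 * pi}"
proof (rule inj_onI)
  have "cis a \<noteq> cis b" if "a < b" "a \<in> {0<..<2 * pi}" "b \<in> {0<..<2 * pi}" for a b
    using sin_half_pos[of "b - a"] cmod_cis_diff[of a b] cmod_one_minus_cis[of "b - a"] that by auto
  then show "a = b" if "a \<in> {0<..<2 * pi}" "b \<in> {0<..<2 * pi}" "cis a = cis b" for a b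
    using that by (metis linorder_neqE)
qed

lemma chord_potential_minus: "chord_potential (- u) = chord_potential u"
  by (simp add: chord_potential_def cmod_one_minus_cis)

lemma chord_potential_eq: "u \<in> {0<..<2 * pi} \<Longrightarrow> chord_potential u = - ln (2 * sin (u / 2))"
  using sin_half_pos[of u] by (simp add: chord_potential_def cmod_one_minus_cis ln_div)

lemma DERIV_chord_potential:
  assumes "u \<in> {0<..<2 * pi}"
  shows "DERIV chord_potential u :> - (cot (u / 2) / 2)"
proof (rule has_field_derivative_transform_within_open)
  show "((\<lambda>u. - ln (2 * sin (u / 2))) has_field_derivative - (cot (u / 2) / 2)) (at u)"
    using sin_half_pos[OF assms]
    by (auto intro!: derivative_eq_intros simp: cot_def field_simps)
  show "- ln (2 * sin (v / 2)) = chord_potential v" if "v \<in> {0<..<2 * pi}" for v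
    using chord_potential_eq[OF that] by simp
qed (use assms in auto)

lemma convex_on_chord_potential: "convex_on {0<..<2 * pi} chord_potential"
proof (rule f''_ge0_imp_convex)
  show "DERIV (\<lambda>u. - (cot (u / 2) / 2)) u :> inverse ((sin (u / 2))\<^sup>2) / 4" if "u \<in> {0<..<2 * pi}" for u
    using sin_half_pos[OF that] by (auto intro!: derivative_eq_intros DERIV_chain2[OF DERIV_cot])
qed (auto intro: DERIV_chord_potential)

lemma chord_potential_tangent:
  assumes "u \<in> {0<..<2 * pi}" "v \<in> {0<..<2 * pi}"
  shows "chord_potential v - cot (v / 2) / 2 * (u - v) \<le> chord_potential u"
  using convex_on_imp_above_tangent[OF convex_on_chord_potential, of v u "- (cot (v / 2) / 2)"]
    assms DERIV_chord_potential[OF assms(2)]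
  by (simp add: interior_open at_within_open_NO_MATCH algebra_simps)

lemma chord_potential_at_right_0: "filterlim chord_potential at_top (at_right 0)"
proof -
  have tendsto: "((\<lambda>u. 2 * sin (u / 2)) \<longlongrightarrow> 2 * sin (0 / 2)) (at_right (0::real))"
    by (intro tendsto_intros) auto
  have near: "eventually (\<lambda>u. u \<in> {0<..<2 * pi}) (at_right (0::real))"
    by (rule eventually_at_right_real) simp
  then have "eventually (\<lambda>u. 2 * sin (u / 2) \<in> {0<..} \<and> 2 * sin (u / 2) \<noteq> 0) (at_right (0::real))"
  proof (rule eventually_mono)
    show "2 * sin (u / 2) \<in> {0<..} \<and> 2 * sin (u / 2) \<noteq> 0" if "u \<in> {0<..<2 * pi}" for u
      using sin_half_pos[OF that] by simp
  qed
  with tendsto have "filterlim (\<lambda>u. 2 * sin (u / 2)) (at_right 0) (at_right (0::real))"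
    unfolding filterlim_at by simp
  then have "filterlim (\<lambda>u. ln (2 * sin (u / 2))) at_bot (at_right (0::real))"
    by (rule filterlim_compose[OF ln_at_0])
  then have lim: "filterlim (\<lambda>u. - ln (2 * sin (u / 2))) at_top (at_right (0::real))"
    by (simp add: filterlim_uminus_at_bot)
  have "eventually (\<lambda>u. - ln (2 * sin (u / 2)) = chord_potential u) (at_right 0)"
    using near by (rule eventually_mono) (rule chord_potential_eq[symmetric])
  with lim show ?thesis
    by (simp cong: filterlim_cong)
qed

text \<open>Pulling out \<open>cis ((a + b) / 2)\<close> leaves
  \<open>cis t / (2 * \<i> * sin t)\<close> with \<open>t\<close> half the angle difference. This
  links sums over roots to the cotangents in the gradient.\<close>

lemma cis_ratio_cot:
  assumes "cis a \<noteq> cis b"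
  shows "cis a / (cis a - cis b) = 1 / 2 - \<i> / 2 * of_real (cot ((a - b) / 2))"
proof -
  define t where "t = (a - b) / 2"
  have ab: "cis a = cis ((a + b) / 2) * cis t" "cis b = cis ((a + b) / 2) * cis (- t)"
    by (simp_all add: t_def cis_mult field_simps)
  have "cis t - cis (- t) = 2 * \<i> * sin t"
    by (simp add: complex_eq_iff)
  then have d: "cis a - cis b = cis ((a + b) / 2) * (2 * \<i> * sin t)"
    by (simp only: ab flip: right_diff_distrib)
  then have "sin t \<noteq> 0"
    using assms by auto
  have "cis a / (cis a - cis b) = cis t / (2 * \<i> * sin t)"
    unfolding d unfolding ab(1) by simp
  also have "\<dots> = 1 / 2 - \<i> / 2 * of_real (cot t)"
    using \<open>sin t \<noteq> 0\<close> by (simp add: cot_def complex_eq_iff Re_divide Im_divide power2_eq_square field_simps)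
  finally show ?thesis by (simp add: t_def)
qed

section \<open>Double sums and sorting\<close>

text \<open>Symmetry makes the two strict triangles equal, and the diagonal is zero. Unlike a sum
  over \<open>k < j\<close>, the full double sum can be reindexed freely.\<close>

lemma sum_upper_triangle:
  fixes g :: "'n::{finite, linorder} \<Rightarrow> 'n \<Rightarrow> real"
  assumes "\<And>k j. g j k = g k j" and "\<And>k. g k k = 0"
  shows "(\<Sum>k\<in>UNIV. \<Sum>j\<in>UNIV. g k j) = 2 * (\<Sum>k\<in>UNIV. \<Sum>j\<in>{k<..}. g k j)"
proof -
  have "(\<Sum>k\<in>UNIV. \<Sum>j\<in>{..<k}. g k j) = (\<Sum>k\<in>UNIV. \<Sum>j\<in>{k<..}. g k j)"
    using sum.swap_restrict[of UNIV UNIV "\<lambda>k j. g j k" "\<lambda>k j. k < j"]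
    by (simp add: assms(1) lessThan_def greaterThan_def)
  moreover have "(\<Sum>j\<in>UNIV. g k j) = (\<Sum>j\<in>{..<k}. g k j) + (\<Sum>j\<in>{k<..}. g k j)" for k
  proof -
    have "(UNIV :: 'n set) = insert k ({..<k} \<union> {k<..})"
      by auto
    then have "(\<Sum>j\<in>UNIV. g k j) = (\<Sum>j\<in>insert k ({..<k} \<union> {k<..}). g k j)"
      by (rule arg_cong)
    also have "\<dots> = (\<Sum>j\<in>{..<k} \<union> {k<..}. g k j)"
      by (subst sum.insert) (auto simp: assms(2))
    finally show ?thesis
      by (subst (asm) sum.union_disjoint) auto
  qed
  ultimately show ?thesis
    by (simp add: sum.distrib)
qed

text \<open>Rank increases strictly with the value, so it is injective; its values lie below
  \<open>card A\<close>, and counting gives surjectivity.\<close>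

lemma rank_bij_betw:
  fixes f :: "'a \<Rightarrow> 'b::linorder"
  assumes "finite A" "inj_on f A"
  shows "bij_betw (\<lambda>j. card {i \<in> A. f i < f j}) A {..<card A}"
proof -
  have less: "card {i \<in> A. f i < f k} < card {i \<in> A. f i < f j}" if "k \<in> A" "f k < f j" for k j
  proof (rule psubset_card_mono)
    show "{i \<in> A. f i < f k} \<subset> {i \<in> A. f i < f j}"
      using that less_trans by blast
  qed (use assms(1) in simp)
  have inj: "inj_on (\<lambda>j. card {i \<in> A. f i < f j}) A"
  proof (rule inj_onI)
    fix k j
    assume "k \<in> A" "j \<in> A" and "card {i \<in> A. f i < f k} = card {i \<in> A. f i < f j}"
    then have "f k = f j"
      using less[of k j] less[of j k] by (cases "f k" "f j" rule: linorder_cases) simp_all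
    then show "k = j"
      using assms(2) \<open>k \<in> A\<close> \<open>j \<in> A\<close> by (simp add: inj_on_eq_iff)
  qed
  have "(\<lambda>j. card {i \<in> A. f i < f j}) ` A \<subseteq> {..<card A}"
  proof (rule image_subsetI)
    fix j
    assume "j \<in> A"
    then have "{i \<in> A. f i < f j} \<subset> A"
      by blast
    then show "card {i \<in> A. f i < f j} \<in> {..<card A}"
      using psubset_card_mono[OF assms(1)] by simp
  qed
  then show ?thesis
    using inj by (simp add: bij_betw_def card_image card_subset_eq)
qed

lemma sorting_permutation:
  fixes x :: "'n::{finite, linorder} \<Rightarrow> real"
  assumes "inj x"
  obtains \<sigma> :: "'n \<Rightarrow> 'n" where "bij \<sigma>" and "\<And>k j. k < j \<Longrightarrow> x (\<sigma> k) < x (\<sigma> j)"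
proof -
  define r where "r j = card {i. x i < x j}" for j
  define s where "s j = card {i. i < j}" for j :: 'n
  have r: "bij_betw r UNIV {..<CARD('n)}" and s: "bij_betw s UNIV {..<CARD('n)}"
    using rank_bij_betw[of UNIV x] rank_bij_betw[of UNIV "\<lambda>j::'n. j"] assms
    by (simp_all add: r_def[abs_def] s_def[abs_def])
  have mono: "r j \<le> r k" if "x j \<le> x k" for j k
    unfolding r_def using that by (intro card_mono) auto
  \<comment> \<open>An index goes to the one whose value under \<open>x\<close> has the same
    rank.\<close>
  define \<sigma> where "\<sigma> = inv_into UNIV r \<circ> s"
  have r\<sigma>: "r (\<sigma> j) = s j" for j
    using r s by (auto simp: \<sigma>_def bij_betw_def intro!: f_inv_into_f)
  show ?thesis
  proof (rule that[of \<sigma>])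
    show "bij \<sigma>"
      unfolding \<sigma>_def using bij_betw_trans[OF s bij_betw_inv_into[OF r]] .
    show "x (\<sigma> k) < x (\<sigma> j)" if "k < j" for k j
    proof (rule ccontr)
      assume "\<not> x (\<sigma> k) < x (\<sigma> j)"
      then have "s j \<le> s k"
        using mono r\<sigma> by (metis not_le)
      moreover have "s k < s j"
        unfolding s_def using that by (intro psubset_card_mono) auto
      ultimately show False by simp
    qed
  qed
qed

section \<open>The energy on ordered configurations\<close>

text \<open>The real-valued energy in terms of differences \<open>x $ j - x $ k\<close> with
  \<open>k < j\<close>. For increasing angles these lie in the interval where
  \<open>chord_potential\<close> is smooth and convex.\<close>

definition finite_energy :: "real \<Rightarrow> real \<Rightarrow> real ^ 'n::{finite, linorder} \<Rightarrow> real" where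
  "finite_energy p q x =
     (\<Sum>k\<in>UNIV. \<Sum>j\<in>{k<..}. chord_potential (x $ j - x $ k)) +
     p * (\<Sum>j\<in>UNIV. chord_potential (x $ j)) + q * (\<Sum>j\<in>UNIV. x $ j)"

lemma circle_energy_eq_finite_energy:
  fixes x :: "real ^ 'n::{finite, linorder}"
  assumes "x \<in> angle_domain" and "inj (\<lambda>j. x $ j)"
  shows "circle_energy p q x = ereal (finite_energy p q x)"
proof -
  have "log_interaction (cmod (cis (x $ k) - cis (x $ j))) = ereal (chord_potential (x $ j - x $ k))"
    if "j \<in> {k<..}" for k j
  proof -
    have "x $ k \<noteq> x $ j"
      using assms(2) that by (auto dest: injD)
    then have "cis (x $ k) \<noteq> cis (x $ j)"
      using assms(1) cis_inj_on by (simp add: angle_domain_def inj_on_eq_iff)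
    then show ?thesis
      unfolding log_interaction_def chord_potential_def cmod_cis_diff[symmetric] by simp
  qed
  then show ?thesis
    by (simp add: circle_energy_def finite_energy_def chord_potential_def)
qed

lemma circle_energy_eq_infinity:
  fixes x :: "real ^ 'n::{finite, linorder}"
  assumes "\<not> inj (\<lambda>j. x $ j)"
  shows "circle_energy p q x = \<infinity>"
proof -
  obtain k j where "x $ k = x $ j" "k < j"
    using assms unfolding inj_def by (metis linorder_neqE)
  then have "log_interaction (cmod (cis (x $ k) - cis (x $ j))) = \<infinity>" and "j \<in> {k<..}"
    by (simp_all add: log_interaction_def)
  then have "(\<Sum>k\<in>UNIV. \<Sum>j\<in>{k<..}. log_interaction (cmod (cis (x $ k) - cis (x $ j)))) = \<infinity>"
    unfolding sum_Pinfty by (metis UNIV_I finite)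
  then show ?thesis
    by (simp add: circle_energy_def)
qed

text \<open>Twice the pair sum is the full double sum, since \<open>chord_potential\<close> is even
  and zero at 0; all sums then run over \<open>UNIV\<close> and are reindexed by the
  bijection.\<close>

lemma finite_energy_permute:
  fixes x :: "real ^ 'n::{finite, linorder}" and \<sigma> :: "'n \<Rightarrow> 'n"
  assumes "bij \<sigma>"
  shows "finite_energy p q (\<chi> j. x $ \<sigma> j) = finite_energy p q x"
proof -
  have pairs: "2 * (\<Sum>k\<in>UNIV. \<Sum>j\<in>{k<..}. chord_potential (y $ j - y $ k)) =
      (\<Sum>k\<in>UNIV. \<Sum>j\<in>UNIV. chord_potential (y $ j - y $ k))" for y :: "(real, 'n) vec"
    by (rule sum_upper_triangle[symmetric])
      (use chord_potential_minus[of "y $ _ - y $ _"] in \<open>simp_all add: chord_potential_def\<close>)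
  have "(\<Sum>k\<in>UNIV. \<Sum>j\<in>UNIV. chord_potential (x $ \<sigma> j - x $ \<sigma> k)) =
      (\<Sum>k\<in>UNIV. \<Sum>j\<in>UNIV. chord_potential (x $ j - x $ k))"
    using sum.reindex_bij_betw[OF assms, of "\<lambda>j. chord_potential (x $ j - x $ _)"]
      sum.reindex_bij_betw[OF assms, of "\<lambda>k. \<Sum>j\<in>UNIV. chord_potential (x $ j - x $ k)"]
    by simp
  then show ?thesis
    using pairs[of x] pairs[of "\<chi> j. x $ \<sigma> j"] sum.reindex_bij_betw[OF assms, of "\<lambda>j. x $ j"]
      sum.reindex_bij_betw[OF assms, of "\<lambda>j. chord_potential (x $ j)"]
    by (simp add: finite_energy_def)
qed

definition ordered_angles :: "(real ^ 'n::{finite, linorder}) set" where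
  "ordered_angles = {x \<in> angle_domain. \<forall>k j. k < j \<longrightarrow> x $ k < x $ j}"

lemma ordered_angles_imp:
  assumes "x \<in> ordered_angles"
  shows "x \<in> angle_domain" and "inj (\<lambda>j. x $ j)" and "x $ j \<in> {0<..<2 * pi}"
    and "k < j \<Longrightarrow> x $ j - x $ k \<in> {0<..<2 * pi}"
proof -
  have *: "0 < x $ i \<and> x $ i < 2 * pi" for i
    using assms by (simp add: ordered_angles_def angle_domain_def)
  show "x \<in> angle_domain"
    using assms by (simp add: ordered_angles_def)
  show "inj (\<lambda>j. x $ j)"
    using assms by (intro injI) (metis (mono_tags, lifting) ordered_angles_def mem_Collect_eq less_irrefl linorder_neqE)
  show "x $ j \<in> {0<..<2 * pi}"
    using * by simp
  show "x $ j - x $ k \<in> {0<..<2 * pi}" if "k < j"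
  proof -
    have "x $ k < x $ j"
      using assms that by (simp add: ordered_angles_def)
    then show ?thesis
      using *[of j] *[of k] by simp
  qed
qed

text \<open>Openness allows the derivative of \<open>circle_energy\<close> at an ordered point to be
  taken from \<open>finite_energy\<close>, with which it agrees on this set.\<close>

lemma open_ordered_angles: "open (ordered_angles :: (real ^ 'n::{finite, linorder}) set)"
proof -
  have "ordered_angles = (\<Inter>j. {x :: (real, 'n) vec. 0 < x $ j} \<inter> {x. x $ j < 2 * pi}) \<inter>
      (\<Inter>k. \<Inter>j\<in>{k<..}. {x. x $ k < x $ j})"
    by (auto simp: ordered_angles_def angle_domain_def)
  also have "open \<dots>"
    by (intro open_Int open_INT ballI finite open_Collect_less continuous_intros)
  finally show ?thesis .
qed

section \<open>Differential and tangent inequality of the energy\<close>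

definition energy_differential ::
    "real \<Rightarrow> real \<Rightarrow> real ^ 'n::{finite, linorder} \<Rightarrow> real ^ 'n::{finite, linorder} \<Rightarrow> real" where
  "energy_differential p q x h =
     (\<Sum>k\<in>UNIV. \<Sum>j\<in>{k<..}. - (cot ((x $ j - x $ k) / 2) / 2) * (h $ j - h $ k)) +
     p * (\<Sum>j\<in>UNIV. - (cot (x $ j / 2) / 2) * h $ j) + q * (\<Sum>j\<in>UNIV. h $ j)"

lemma has_derivative_finite_energy:
  assumes "x \<in> ordered_angles"
  shows "(finite_energy p q has_derivative energy_differential p q x) (at x)"
proof -
  note [derivative_intros] = DERIV_chord_potential[THEN DERIV_compose_FDERIV]
  have "((\<lambda>x. chord_potential (x $ j - x $ k)) has_derivative
      (\<lambda>h. - (cot ((x $ j - x $ k) / 2) / 2) * (h $ j - h $ k))) (at x)" if "j \<in> {k<..}" for k j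
    using ordered_angles_imp(4)[OF assms] that
    by (auto intro!: derivative_eq_intros bounded_linear.has_derivative[OF bounded_linear_vec_nth] ext)
  moreover have "((\<lambda>x. chord_potential (x $ j)) has_derivative
      (\<lambda>h. - (cot (x $ j / 2) / 2) * h $ j)) (at x)" for j
    using ordered_angles_imp(3)[OF assms, of j]
    by (auto intro!: derivative_eq_intros bounded_linear.has_derivative[OF bounded_linear_vec_nth] ext)
  ultimately show ?thesis
    unfolding finite_energy_def[abs_def] energy_differential_def[abs_def]
    by (intro has_derivative_add has_derivative_sum has_derivative_mult_right
        bounded_linear.has_derivative[OF bounded_linear_vec_nth] has_derivative_ident)
qed

text \<open>The tangent inequality for \<open>chord_potential\<close> is summed over pairs and over
  single angles; \<open>p \<ge> 0\<close> preserves it in the second sum. The term in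
  \<open>q\<close> is linear and gives equality.\<close>

lemma finite_energy_above_tangent:
  assumes "x \<in> ordered_angles" "y \<in> ordered_angles" "p \<ge> 0"
  shows "finite_energy p q x + energy_differential p q x (y - x) \<le> finite_energy p q y"
proof -
  have "(\<Sum>k\<in>UNIV. \<Sum>j\<in>{k<..}. chord_potential (x $ j - x $ k) +
        - (cot ((x $ j - x $ k) / 2) / 2) * ((y - x) $ j - (y - x) $ k))
      \<le> (\<Sum>k\<in>UNIV. \<Sum>j\<in>{k<..}. chord_potential (y $ j - y $ k))"
    using chord_potential_tangent[OF ordered_angles_imp(4)[OF assms(2)] ordered_angles_imp(4)[OF assms(1)]]
    by (intro sum_mono) (simp add: algebra_simps)
  moreover have "p * (\<Sum>j\<in>UNIV. chord_potential (x $ j) + - (cot (x $ j / 2) / 2) * (y - x) $ j)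
      \<le> p * (\<Sum>j\<in>UNIV. chord_potential (y $ j))"
    using chord_potential_tangent[OF ordered_angles_imp(3)[OF assms(2)] ordered_angles_imp(3)[OF assms(1)]]
    by (intro mult_left_mono sum_mono assms(3)) (simp add: algebra_simps)
  moreover have "q * (\<Sum>j\<in>UNIV. (y - x) $ j) = q * (\<Sum>j\<in>UNIV. y $ j) - q * (\<Sum>j\<in>UNIV. x $ j)"
    by (simp add: sum_subtractf right_diff_distrib)
  ultimately show ?thesis
    unfolding finite_energy_def energy_differential_def by (simp only: sum.distrib distrib_left)
qed

text \<open>Antisymmetry of the cotangent regroups the pair sum by the components of
  \<open>h\<close>; the assumption then says that each coefficient is zero. Its term
  \<open>k = j\<close> is harmless because \<open>cot 0 = 0\<close>.\<close>

lemma energy_differential_eq_0: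
  fixes x :: "real ^ 'n::{finite, linorder}"
  assumes "\<And>j. (\<Sum>k\<in>UNIV. cot ((x $ j - x $ k) / 2)) + p * cot (x $ j / 2) = 2 * q"
  shows "energy_differential p q x h = 0"
proof -
  define c where "c j k = cot ((x $ j - x $ k) / 2) / 2" for j k
  have anti: "c k j = - c j k" for j k
  proof -
    have "(x $ k - x $ j) / 2 = - ((x $ j - x $ k) / 2)"
      by (simp only: minus_divide_left minus_diff_eq)
    then have "cot ((x $ k - x $ j) / 2) = - cot ((x $ j - x $ k) / 2)"
      by (metis cot_minus)
    then show ?thesis
      by (simp add: c_def)
  qed
  have "2 * (\<Sum>k\<in>UNIV. \<Sum>j\<in>{k<..}. - c j k * (h $ j - h $ k)) =
      (\<Sum>k\<in>UNIV. \<Sum>j\<in>UNIV. - c j k * (h $ j - h $ k))"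
  proof (rule sum_upper_triangle[symmetric])
    show "- c k j * (h $ k - h $ j) = - c j k * (h $ j - h $ k)" for k j
      by (simp add: anti[of j k] algebra_simps)
  qed simp
  also have "\<dots> = (\<Sum>k\<in>UNIV. \<Sum>j\<in>UNIV. - c j k * h $ j) + (\<Sum>k\<in>UNIV. \<Sum>j\<in>UNIV. - c k j * h $ k)"
    unfolding sum.distrib[symmetric]
  proof (intro sum.cong refl)
    show "- c j k * (h $ j - h $ k) = - c j k * h $ j + - c k j * h $ k" for k j
      by (simp add: anti[of j k] algebra_simps)
  qed
  also have "\<dots> = 2 * (\<Sum>j\<in>UNIV. \<Sum>k\<in>UNIV. - c j k * h $ j)"
    by (subst sum.swap) simp
  finally have "(\<Sum>k\<in>UNIV. \<Sum>j\<in>{k<..}. - c j k * (h $ j - h $ k)) =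
      (\<Sum>j\<in>UNIV. - (\<Sum>k\<in>UNIV. c j k) * h $ j)"
    by (simp add: sum_distrib_right sum_negf)
  then have "energy_differential p q x h =
      (\<Sum>j\<in>UNIV. (q - (\<Sum>k\<in>UNIV. c j k) - p * cot (x $ j / 2) / 2) * h $ j)"
    unfolding energy_differential_def c_def sum_distrib_left
    by (simp only: sum.distrib[symmetric]) (intro sum.cong refl, simp add: field_simps)
  moreover have "q - (\<Sum>k\<in>UNIV. c j k) - p * cot (x $ j / 2) / 2 = 0" for j
    using assms[of j] by (simp add: c_def flip: sum_divide_distrib)
  ultimately show ?thesis
    by simp
qed

section \<open>From zeros of the polynomial to equilibrium equations\<close>

lemma para_orth_zeros_equilibrium:
  fixes x :: "real ^ 'n::{finite, linorder}"
  assumes p: "p \<noteq> 0" "p > - 1 / 2" and x: "x \<in> angle_domain" "inj (\<lambda>j. x $ j)"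
    and zeros: "{z. para_orth_B CARD('n) (of_real p) (2 * \<i> * of_real q) z = 0} = range (\<lambda>j. cis (x $ j))"
  shows "(\<Sum>k\<in>UNIV. cot ((x $ j - x $ k) / 2)) + p * cot (x $ j / 2) = 2 * q"
proof -
  define n where "n = CARD('n)"
  define b where "b = complex_of_real p + 2 * \<i> * of_real q"
  define c where "c = 2 * complex_of_real p"
  define F where "F = hypergeo_poly n b c"
  \<comment> \<open>The real parts are \<open>p + m\<close> here and \<open>2 * p + m\<close> for
    \<open>c\<close>: nonzero at \<open>m = 0\<close> since \<open>p \<noteq> 0\<close>, positive
    for larger \<open>m\<close> since \<open>p > - 1 / 2\<close>.\<close>
  have b_nz: "b + of_nat m \<noteq> 0" for m
    using p by (cases m) (auto simp: b_def complex_eq_iff)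
  have c_nz: "c + of_nat m \<noteq> 0" for m
    using p by (cases m) (auto simp: c_def complex_eq_iff)
  have poch: "pochhammer b n \<noteq> 0" "pochhammer c n \<noteq> 0"
    using b_nz c_nz by (auto simp: pochhammer_eq_0_iff eq_neg_iff_add_eq_0)
  have deg: "degree F = n"
    unfolding F_def using poch by (rule degree_hypergeo_poly)
  have inj: "inj (\<lambda>j. 1 - cis (x $ j))"
    using x cis_inj_on by (auto simp: inj_def inj_on_def angle_domain_def)
  have "para_orth_B n (of_real p) (2 * \<i> * of_real q) z = 0 \<longleftrightarrow> poly F (1 - z) = 0" for z
    using poch by (simp add: para_orth_B_def F_def poly_hypergeo_poly b_def c_def)
  then have "poly F w = 0 \<longleftrightarrow> 1 - w \<in> range (\<lambda>j. cis (x $ j))" for w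
    unfolding zeros[folded n_def, symmetric] by simp
  then have R: "{w. poly F w = 0} = range (\<lambda>j. 1 - cis (x $ j))"
    by (auto simp: image_iff algebra_simps)
  \<comment> \<open>The \<open>n\<close> distinct points exhaust the degree, so every root of
    \<open>F\<close> is simple.\<close>
  have F: "F \<noteq> 0" "card {w. poly F w = 0} = degree F"
    using poch card_image[OF inj] deg unfolding R by (auto simp: n_def)
  define z where "z = cis (x $ j)"
  define T where "T = (\<Sum>k\<in>UNIV. cot ((x $ j - x $ k) / 2))"
  define S where "S = (\<Sum>v\<in>{w. poly F w = 0} - {1 - z}. 1 / (1 - z - v))"
  have root: "poly F (1 - z) = 0"
    using R by (auto simp: z_def)
  have "S = (\<Sum>v\<in>(\<lambda>k. 1 - cis (x $ k)) ` (UNIV - {j}). 1 / (1 - z - v))"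
    using inj unfolding S_def R z_def by (intro sum.cong) (auto simp: inj_def)
  also have "\<dots> = (\<Sum>k\<in>UNIV - {j}. 1 / (cis (x $ k) - z))"
    using inj by (subst sum.reindex) (auto intro: inj_on_subset)
  finally have "z * S = (\<Sum>k\<in>UNIV - {j}. z / (cis (x $ k) - z))"
    by (simp add: sum_distrib_left)
  also have "\<dots> = - (\<Sum>k\<in>UNIV - {j}. z / (z - cis (x $ k)))"
    unfolding sum_negf[symmetric] by (intro sum.cong refl) (simp add: minus_divide_right)
  also have "(\<Sum>k\<in>UNIV - {j}. z / (z - cis (x $ k))) =
      (\<Sum>k\<in>UNIV - {j}. 1 / 2 - \<i> / 2 * of_real (cot ((x $ j - x $ k) / 2)))"
    unfolding z_def using inj by (intro sum.cong refl cis_ratio_cot) (auto simp: inj_def)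
  \<comment> \<open>There are \<open>n - 1\<close> summands, while \<open>T\<close> runs over all
    \<open>k\<close>; its extra term is \<open>cot 0 = 0\<close>.\<close>
  also have "\<dots> = (of_nat n - 1) / 2 - \<i> / 2 * of_real T"
    by (simp add: sum_subtractf T_def sum.remove[of UNIV j "\<lambda>k. cot ((x $ j - x $ k) / 2)"] n_def
        sum_distrib_left)
  finally have zS: "z * S = - ((of_nat n - 1) / 2 - \<i> / 2 * of_real T)" .
  have z1: "z \<noteq> 1"
  proof -
    have "cmod (1 - z) > 0"
      unfolding z_def cmod_one_minus_cis using x(1) sin_half_pos[of "x $ j"] by (simp add: angle_domain_def)
    then show ?thesis by auto
  qed
  then have inv: "1 / (1 - z) = 1 / 2 + \<i> / 2 * of_real (cot (x $ j / 2))"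
    using cis_ratio_cot[of 0 "x $ j"] by (simp add: z_def)
  \<comment> \<open>At a root the zero-order term of the differential equation drops out, and the
    second derivative is expressed by the first and \<open>S\<close>.\<close>
  have "poly (pderiv F) (1 - z) * (2 * (1 - z) * (z * S) + c - (1 - of_nat n + b) * (1 - z)) = 0"
    using hypergeo_ode[OF c_nz, of "1 - z" n b]
    unfolding F_def[symmetric] pderiv2_at_simple_root(2)[OF F root, folded S_def] root
    by (simp add: algebra_simps)
  then have "2 * (1 - z) * (z * S) + c - (1 - of_nat n + b) * (1 - z) = 0"
    using pderiv2_at_simple_root(1)[OF F root] by simp
  then have "2 * (z * S) + c * (1 / (1 - z)) - (1 - of_nat n + b) = 0"
    using z1 by (simp add: field_simps)
  \<comment> \<open>The real parts \<open>- (n - 1)\<close>, \<open>p\<close> and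
    \<open>n - 1 - p\<close> cancel, leaving a purely imaginary identity.\<close>
  then have "\<i> * of_real (T + p * cot (x $ j / 2) - 2 * q) = 0"
    unfolding zS inv b_def c_def by (simp add: algebra_simps diff_divide_distrib)
  then show ?thesis
    by (simp add: T_def del: of_real_add of_real_diff of_real_mult)
qed

section \<open>Unboundedness for negative \<open>p\<close>\<close>

lemma circle_energy_unbounded_below:
  fixes \<theta> :: "real ^ 'n::{finite, linorder}"
  assumes "\<theta> \<in> ordered_angles" and "p < 0"
  shows "\<exists>x\<in>(angle_domain :: (real, 'n) vec set). circle_energy p q x < ereal a"
proof -
  \<comment> \<open>The first angle can slide down to 0 without meeting another one.\<close>
  define i where "i = Min (UNIV :: 'n set)"
  have i_less: "i < j \<longleftrightarrow> j \<noteq> i" for j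
    unfolding i_def by (metis Min_le UNIV_I finite less_irrefl order_le_neq_trans)
  define y where "y \<epsilon> = (\<chi> j. if j = i then \<epsilon> else \<theta> $ j)" for \<epsilon>
  \<comment> \<open>Everything except the interaction of the moving point with the fixed charge;
    this part stays convergent.\<close>
  define V where "V \<epsilon> = (\<Sum>k\<in>UNIV. \<Sum>j\<in>{k<..}. chord_potential (y \<epsilon> $ j - y \<epsilon> $ k)) +
      p * (\<Sum>j\<in>UNIV - {i}. chord_potential (\<theta> $ j)) + q * (\<Sum>j\<in>UNIV. y \<epsilon> $ j)" for \<epsilon>
  have y_lim: "((\<lambda>\<epsilon>. y \<epsilon> $ j) \<longlongrightarrow> y 0 $ j) (at_right 0)" for j
    by (simp add: y_def)
  \<comment> \<open>Even in the limit the points stay apart: differences from the moving angle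
    become the other angles themselves, so \<open>chord_potential\<close> is continuous
    there.\<close>
  have "y 0 $ j - y 0 $ k \<in> {0<..<2 * pi}" if "j \<in> {k<..}" for k j
    using that ordered_angles_imp(3,4)[OF assms(1)] i_less[of k] i_less[of j]
    by (auto simp: y_def)
  then have "((\<lambda>\<epsilon>. chord_potential (y \<epsilon> $ j - y \<epsilon> $ k)) \<longlongrightarrow> chord_potential (y 0 $ j - y 0 $ k)) (at_right 0)"
    if "j \<in> {k<..}" for k j
    using that by (intro isCont_tendsto_compose[OF DERIV_isCont[OF DERIV_chord_potential]] tendsto_diff y_lim)
  then have "(V \<longlongrightarrow> V 0) (at_right 0)"
    unfolding V_def[abs_def] by (intro tendsto_intros y_lim)
  moreover have "filterlim (\<lambda>\<epsilon>. p * chord_potential \<epsilon>) at_bot (at_right 0)"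
    using chord_potential_at_right_0 assms(2)
    by (intro filterlim_tendsto_neg_mult_at_bot[OF tendsto_const])
  ultimately have "filterlim (\<lambda>\<epsilon>. V \<epsilon> + p * chord_potential \<epsilon>) at_bot (at_right 0)"
    by (simp add: filterlim_tendsto_add_at_bot_iff)
  moreover have "finite_energy p q (y \<epsilon>) = V \<epsilon> + p * chord_potential \<epsilon>" for \<epsilon>
  proof -
    have "(\<Sum>j\<in>UNIV. chord_potential (y \<epsilon> $ j)) =
        chord_potential \<epsilon> + (\<Sum>j\<in>UNIV - {i}. chord_potential (\<theta> $ j))"
      by (subst sum.remove[of UNIV i]) (auto simp: y_def)
    then show ?thesis
      by (simp add: finite_energy_def V_def distrib_left)
  qed
  ultimately have "eventually (\<lambda>\<epsilon>. finite_energy p q (y \<epsilon>) < a) (at_right 0)"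
    by (simp add: filterlim_at_bot_dense)
  \<comment> \<open>Below \<open>\<theta> $ i\<close> the moved configuration is still ordered, so
    its energy is given by \<open>finite_energy\<close>.\<close>
  moreover have "eventually (\<lambda>\<epsilon>. \<epsilon> \<in> {0<..<\<theta> $ i}) (at_right 0)"
    using ordered_angles_imp(3)[OF assms(1), of i] by (intro eventually_at_right_real) simp
  ultimately have "eventually (\<lambda>\<epsilon>. finite_energy p q (y \<epsilon>) < a \<and> \<epsilon> \<in> {0<..<\<theta> $ i}) (at_right 0)"
    by (rule eventually_conj)
  then obtain \<epsilon> where \<epsilon>: "finite_energy p q (y \<epsilon>) < a" "0 < \<epsilon>" "\<epsilon> < \<theta> $ i"
    using eventually_happens'[OF trivial_limit_at_right_real] by fastforce
  have less: "\<theta> $ k < \<theta> $ j" if "k < j" for k j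
    using ordered_angles_imp(4)[OF assms(1) that] by simp
  have "y \<epsilon> $ j \<in> {0<..<2 * pi}" for j
    using ordered_angles_imp(3)[OF assms(1), of j] \<epsilon>(2,3) by (auto simp: y_def)
  moreover have "y \<epsilon> $ k < y \<epsilon> $ j" if "k < j" for k j
    using less[OF that] less[of i j] \<epsilon>(3) that i_less[of k] i_less[of j] by (auto simp: y_def)
  ultimately have "y \<epsilon> \<in> ordered_angles"
    by (simp add: ordered_angles_def angle_domain_def)
  then show ?thesis
    using \<epsilon>(1)
    by (intro bexI[of _ "y \<epsilon>"]) (simp_all add: circle_energy_eq_finite_energy ordered_angles_imp)
qed

section \<open>Vanishing gradient and the sign of \<open>p\<close>\<close>

theorem theorem2:
  fixes p q :: real and \<theta> :: "real ^ 'n::{finite, linorder}"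
  assumes "CARD('n) \<ge> 2"
    and "p \<noteq> 0" and "p > - 1 / 2"
    and "\<theta> \<in> angle_domain"
    and "\<forall>k j. k < j \<longrightarrow> \<theta> $ k < \<theta> $ j"
    and "{z. para_orth_B CARD('n) (of_real p) (2 * \<i> * of_real q) z = 0} = range (\<lambda>j. cis (\<theta> $ j))"
  shows "(GDERIV (\<lambda>x. real_of_ereal (circle_energy p q x)) \<theta> :> 0) \<and>
    ((\<forall>x\<in>(angle_domain :: (real ^ 'n::{finite, linorder}) set). circle_energy p q \<theta> \<le> circle_energy p q x) \<longleftrightarrow> p > 0)"
proof (intro conjI iffI ballI)
  have \<theta>: "\<theta> \<in> ordered_angles"
    using assms(4,5) by (simp add: ordered_angles_def)
  note energy_\<theta> = circle_energy_eq_finite_energy[OF ordered_angles_imp(1,2)]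
  have crit: "energy_differential p q \<theta> h = 0" for h
    using energy_differential_eq_0 para_orth_zeros_equilibrium[OF assms(2,3) ordered_angles_imp(1,2)[OF \<theta>] assms(6)]
    by blast
  have "((\<lambda>x. real_of_ereal (circle_energy p q x)) has_derivative energy_differential p q \<theta>) (at \<theta>)"
    by (rule has_derivative_transform_within_open[OF has_derivative_finite_energy[OF \<theta>] open_ordered_angles \<theta>])
      (simp add: energy_\<theta>)
  then show "GDERIV (\<lambda>x. real_of_ereal (circle_energy p q x)) \<theta> :> 0"
    by (simp add: gderiv_def crit[abs_def])
  show "p > 0" if "\<forall>x\<in>(angle_domain :: (real, 'n) vec set). circle_energy p q \<theta> \<le> circle_energy p q x"
  proof (rule ccontr)
    assume "\<not> p > 0"
    then obtain x :: "(real, 'n) vec" where "x \<in> angle_domain" "circle_energy p q x < ereal (finite_energy p q \<theta>)"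
      using circle_energy_unbounded_below[OF \<theta>] assms(2) by (metis linorder_neqE)
    then show False
      using that energy_\<theta>[OF \<theta> \<theta>] by (metis not_le)
  qed
  show "circle_energy p q \<theta> \<le> circle_energy p q x" if "p > 0" and x: "x \<in> angle_domain" for x :: "(real, 'n) vec"
  proof (cases "inj (\<lambda>j. x $ j)")
    case True
    then obtain \<sigma> :: "'n \<Rightarrow> 'n" where \<sigma>: "bij \<sigma>" "\<And>k j. k < j \<Longrightarrow> x $ \<sigma> k < x $ \<sigma> j"
      using sorting_permutation[OF True] by blast
    then have "(\<chi> j. x $ \<sigma> j) \<in> ordered_angles"
      using x by (simp add: ordered_angles_def angle_domain_def)
    \<comment> \<open>At the critical point the tangent is horizontal, so the tangent inequality
      compares the energies directly; sorting \<open>x\<close> has not changed its energy.\<close>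
    then have "finite_energy p q \<theta> \<le> finite_energy p q (\<chi> j. x $ \<sigma> j)"
      using finite_energy_above_tangent[OF \<theta>, of _ p q] that(1) crit by fastforce
    then show ?thesis
      using x True \<theta> by (simp add: circle_energy_eq_finite_energy energy_\<theta> finite_energy_permute[OF \<sigma>(1)])
  next
    case False
    then show ?thesis
      by (simp add: circle_energy_eq_infinity)
  qed
qed

end
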